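(* For every dimension $n\ge1$ there exists a constant $c$ depending only on $n$ such that for every $p\ge 1$ (with $p<\infty$), every weight $v\in A_p$ on $\mathbb{R}^n$ and every $f\in L^1(v)$, $$\left\| \frac{M_d (fv)}{v} \right\|_{L^{1, \infty}(v)}\le c\,[v]_{A_p}\max\{p,\,\log(e+[v]_{A_p})\}\, \|f\|_{L^1(v)}.$$
   Context: A weight is a nonnegative locally integrable function on $\mathbb{R}^n$. Cubes have sides parallel to the coordinate axes and the suprema below are over cubes $Q\subset\mathbb{R}^n$. For $1<p<\infty$, $[w]_{A_p}=\sup_Q\left(\frac1{|Q|}\int_Q w\right)\left(\frac1{|Q|}\int_Q w^{1-p'}\right)^{p-1}$ with $p'=p/(p-1)$; $[w]_{A_1}=\sup_Q\left(\frac1{|Q|}\int_Q w\right)(\operatorname{ess\,inf}_Q w)^{-1}$; $w\in A_p$ means $[w]_{A_p}<\infty$. $M_d$ is the dyadic maximal operator, $M_d h(x)=\sup_{Q\ni x}\frac1{|Q|}\int_Q|h|$, the supremum over dyadic cubes containing $x$. $\|f\|_{L^1(v)}=\int|f|\,v\,dx$ and $\|F\|_{L^{1,\infty}(v)}=\sup_{t>0} t\, v(\{x:|F(x)|>t\})$, where $v(E)=\int_E v\,dx$. *)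

theory Defs
  imports "HOL-Analysis.Analysis"
begin

definition weight :: "(real ^ 'n \<Rightarrow> real) \<Rightarrow> bool" where
  "weight w \<longleftrightarrow> (\<forall>x. 0 \<le> w x) \<and> (\<forall>K. compact K \<longrightarrow> set_integrable lebesgue K w)"

definition cubes :: "(real ^ 'n) set set" where
  "cubes = {cbox a (\<chi> i. a $ i + l) | a l. 0 < l}"

text \<open>The standard half-open grid \<open>2\<^sup>k (m + [0,1)\<^sup>n)\<close> with \<open>k\<close> and the
  coordinates of \<open>m\<close> ranging over all integers.\<close>

definition dyadic_cubes :: "(real ^ 'n) set set" where
  "dyadic_cubes =
    {{x. \<forall>i. 2 powi k * of_int (m i) \<le> x $ i \<and> x $ i < 2 powi k * (of_int (m i) + 1)}
      | (k :: int) (m :: 'n \<Rightarrow> int). True}"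

definition avg :: "(real ^ 'n) set \<Rightarrow> (real ^ 'n \<Rightarrow> ennreal) \<Rightarrow> ennreal" where
  "avg Q g = (\<integral>\<^sup>+x\<in>Q. g x \<partial>lebesgue) / emeasure lebesgue Q"

definition ess_inf_on :: "(real ^ 'n) set \<Rightarrow> (real ^ 'n \<Rightarrow> ennreal) \<Rightarrow> ennreal" where
  "ess_inf_on Q g = Sup {a. AE x in lebesgue. x \<in> Q \<longrightarrow> a \<le> g x}"

text \<open>Real powers of extended nonnegative reals, with \<open>0\<close> and \<open>\<infinity>\<close> exchanged by negative
  exponents. (The real power \<open>powr\<close> has value \<open>0\<close> at base \<open>0\<close> whatever the exponent, so a
  negative power of a weight that vanishes somewhere has to be taken here instead.)\<close>

definition epowr :: "ennreal \<Rightarrow> real \<Rightarrow> ennreal" where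
  "epowr a s =
    (if s = 0 then 1
     else if a = 0 then (if s < 0 then \<infinity> else 0)
     else if a = \<infinity> then (if s < 0 then 0 else \<infinity>)
     else ennreal (enn2real a powr s))"

text \<open>In \<open>ennreal\<close> we have \<open>0 * \<infinity> = 0\<close> and \<open>inverse 0 = \<infinity>\<close>. A weight that is
  neither a.e. zero nor a.e. positive has infinite characteristic (take a large cube), while the
  zero weight has characteristic \<open>0\<close>.\<close>

definition Ap_char :: "real \<Rightarrow> (real ^ 'n \<Rightarrow> real) \<Rightarrow> ennreal" where
  "Ap_char p w =
    (if p = 1
     then SUP Q\<in>cubes. avg Q (\<lambda>x. ennreal (w x)) * inverse (ess_inf_on Q (\<lambda>x. ennreal (w x)))
     else let p' = p / (p - 1) in
       SUP Q\<in>cubes. avg Q (\<lambda>x. ennreal (w x)) *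
         epowr (avg Q (\<lambda>x. epowr (ennreal (w x)) (1 - p'))) (p - 1))"

definition Ap :: "real \<Rightarrow> (real ^ 'n \<Rightarrow> real) set" where
  "Ap p = {w. weight w \<and> Ap_char p w < \<infinity>}"

definition dyadic_maximal :: "(real ^ 'n \<Rightarrow> real) \<Rightarrow> real ^ 'n \<Rightarrow> ennreal" where
  "dyadic_maximal h x = (SUP Q\<in>{Q \<in> dyadic_cubes. x \<in> Q}. avg Q (\<lambda>y. ennreal \<bar>h y\<bar>))"

definition weighted :: "(real ^ 'n \<Rightarrow> real) \<Rightarrow> (real ^ 'n) measure" where
  "weighted v = density lebesgue (\<lambda>x. ennreal (v x))"

definition L1_norm :: "(real ^ 'n \<Rightarrow> real) \<Rightarrow> (real ^ 'n \<Rightarrow> real) \<Rightarrow> ennreal" where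
  "L1_norm v f = (\<integral>\<^sup>+x. ennreal \<bar>f x\<bar> \<partial>weighted v)"

text \<open>For nonnegative \<open>F\<close>, possibly taking the value \<open>\<infinity>\<close>.\<close>

definition weak_L1_norm :: "(real ^ 'n \<Rightarrow> real) \<Rightarrow> (real ^ 'n \<Rightarrow> ennreal) \<Rightarrow> ennreal" where
  "weak_L1_norm v F =
    (SUP t\<in>{0 :: real<..}. ennreal t * emeasure (weighted v) {x. ennreal t < F x})"

end

theory Submission
  imports Defs
begin

text \<open>
  Put \<open>g = |f| v / t\<close>; the task is to bound \<open>v(E)\<close> by a multiple of \<open>\<integral>g\<close>, where \<open>E\<close> is the set of
  points \<open>x\<close> lying in a dyadic cube \<open>Q\<close> with \<open>v(x) < g\<^sub>Q\<close> (averages over \<open>Q\<close>). If \<open>v\<^sub>Q \<le> 4[v] g\<^sub>Q\<close>, the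
  maximal such cubes contribute at most \<open>4[v] \<integral>g\<close>. The remaining cubes are sorted by
  \<open>v\<^sub>Q \<sim> 4[v] 4\<^sup>i g\<^sub>Q\<close>; each maximal cube \<open>P\<close> of a class has \<open>v(P) \<sim> 4[v] 4\<^sup>i \<integral>\<^sub>P g\<close>, and \<open>E\<close> meets it
  only where \<open>v \<le> s M\<^sub>P v\<close>, with \<open>s = 1 / (4[v] 4\<^sup>i)\<close> and \<open>M\<^sub>P\<close> the dyadic maximal operator
  inside \<open>P\<close>. This set is split along the level sets of \<open>v\<close>. With \<open>u = 1/(p-1)\<close>, the \<open>A\<^sub>p\<close> condition
  bounds the proportion of \<open>Q\<close> where \<open>v \<le> a\<close> by \<open>([v] a / v\<^sub>Q)\<^sup>u\<close>, and also gives
  \<open>v\<^sub>Q \<le> [v] ((\<surd>v)\<^sub>Q)\<^sup>2\<close>, so that the \<open>L\<^sup>2\<close> maximal inequality yields \<open>\<integral>\<^sub>P M\<^sub>P v \<lesssim> [v] v(P)\<close>. Hence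
  the class \<open>i\<close> contributes \<open>\<lesssim> [v] 4\<^sup>-\<^sup>i\<^sup>u \<integral>g\<close>, and the sum over \<open>i\<close> is \<open>\<lesssim> [v] (1 + 1/u) = [v] p\<close>.
  For \<open>p = 1\<close> the same estimates hold with \<open>u = 1\<close>.
\<close>

lemma ennreal_mult_mult:
  "0 \<le> a \<Longrightarrow> 0 \<le> b \<Longrightarrow> a * b = c \<Longrightarrow> ennreal a * (ennreal b * x) = ennreal c * x"
  by (auto simp: ennreal_mult mult.assoc)

section \<open>Laminar families and their maximal members\<close>

locale laminar_family =
  fixes M :: "'a measure" and D :: "'a set set"
  assumes countable_family: "countable D"
    and sets_family: "Q \<in> D \<Longrightarrow> Q \<in> sets M"
    and laminar: "Q \<in> D \<Longrightarrow> R \<in> D \<Longrightarrow> Q \<inter> R = {} \<or> Q \<subseteq> R \<or> R \<subseteq> Q"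
    and finite_supersets: "Q \<in> D \<Longrightarrow> finite {R \<in> D. Q \<subseteq> R}"
begin

lemma sets_Union_family: "F \<subseteq> D \<Longrightarrow> \<Union>F \<in> sets M"
  using countable_family sets_family
  by (intro sets.countable_Union) (auto intro: countable_subset)

text \<open>The maximal members of \<open>F\<close> exist by \<open>finite_supersets\<close>, are
  pairwise disjoint by \<open>laminar\<close>, and have the same union as \<open>F\<close>. An
  estimate on each maximal member can therefore be summed. This does the work of a covering
  argument, with no loss in the constant.\<close>

lemma emeasure_Union_le:
  assumes F: "F \<subseteq> D" and N: "sets N = sets M" and G: "sets G = sets M"
    and X: "X \<in> sets M" and Y: "Y \<in> sets M"
    and le: "\<And>Q. Q \<in> F \<Longrightarrow> (\<And>R. R \<in> F \<Longrightarrow> Q \<subseteq> R \<Longrightarrow> R = Q) \<Longrightarrow>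
      emeasure N (X \<inter> Q) \<le> c * emeasure G (Y \<inter> Q)"
  shows "emeasure N (X \<inter> \<Union>F) \<le> c * emeasure G (Y \<inter> \<Union>F)"
proof -
  define T where "T = {Q \<in> F. \<forall>R\<in>F. Q \<subseteq> R \<longrightarrow> R = Q}"
  have TF: "T \<subseteq> F" "countable T" "T \<subseteq> D"
    using F countable_family by (auto simp: T_def intro: countable_subset)
  have "\<exists>R\<in>T. Q \<subseteq> R" if QF: "Q \<in> F" for Q
  proof -
    have "finite {R \<in> F. Q \<subseteq> R}"
      using QF F by (intro finite_subset[OF _ finite_supersets[of Q]]) auto
    then obtain R where R: "R \<in> {R \<in> F. Q \<subseteq> R}" "\<forall>S\<in>{R \<in> F. Q \<subseteq> R}. R \<subseteq> S \<longrightarrow> R = S"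
      using finite_has_maximal2[of "{R \<in> F. Q \<subseteq> R}" Q] QF by blast
    then have "R \<in> T" by (auto simp: T_def)
    with R show ?thesis by auto
  qed
  with TF have UT: "\<Union>F = \<Union>T" by blast
  have disj: "disjoint_family_on (\<lambda>Q. Z \<inter> Q) T" for Z :: "'a set"
  proof (unfold disjoint_family_on_def, intro ballI impI)
    fix Q R assume "Q \<in> T" "R \<in> T" "Q \<noteq> R"
    then show "Z \<inter> Q \<inter> (Z \<inter> R) = {}"
      using laminar[of Q R] TF by (auto simp: T_def)
  qed
  have eq: "emeasure L (Z \<inter> \<Union>F) = (\<integral>\<^sup>+Q. emeasure L (Z \<inter> Q) \<partial>count_space T)"
    if "sets L = sets M" "Z \<in> sets M" for L Z
  proof -
    have "Z \<inter> \<Union>F = (\<Union>Q\<in>T. Z \<inter> Q)" using UT by auto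
    then show ?thesis
      using that TF sets_family disj by (subst emeasure_UN_countable[symmetric]) auto
  qed
  have "(\<integral>\<^sup>+Q. emeasure N (X \<inter> Q) \<partial>count_space T) \<le> (\<integral>\<^sup>+Q. c * emeasure G (Y \<inter> Q) \<partial>count_space T)"
    using le by (intro nn_integral_mono) (auto simp: T_def)
  then show ?thesis
    using eq[OF N X] eq[OF G Y] by (simp add: nn_integral_cmult)
qed

end

section \<open>Scalar estimates: a geometric sum, negative powers, a tangent line\<close>

lemma nn_integral_geometric_below:
  fixes c y :: real
  assumes c: "0 < c" and y: "0 \<le> y"
  shows "(\<integral>\<^sup>+k. ennreal (c * 2 powi k) * indicator {k. c * 2 powi k < y} k \<partial>count_space (UNIV::int set))
    \<le> ennreal (2 * y)"
proof (cases "y = 0")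
  case True
  then have "{k::int. c * 2 powi k < y} = {}"
    using c by (auto simp: not_less mult_pos_pos)
  then show ?thesis by simp
next
  case False
  with y have y0: "0 < y" by simp
  \<comment> \<open>Every admissible index is at most \<open>j\<close>, and the term at
    \<open>j\<close> is still at most \<open>y\<close>. Counting down from \<open>j\<close> gives a
    geometric series of ratio 1/2, that is, twice its largest term.\<close>
  define j where "j = \<lfloor>log 2 (y / c)\<rfloor>"
  have pw: "2 powi k = 2 powr real_of_int k" for k :: int
    by (simp add: powr_real_of_int')
  have "2 powi j \<le> 2 powr (log 2 (y / c))"
    unfolding pw j_def by (intro powr_mono) auto
  then have j: "c * 2 powi j \<le> y"
    using y0 c by (simp add: field_simps)
  have sub: "k \<le> j" if "c * 2 powi k < y" for k
  proof -
    have "2 powr real_of_int k < y / c" using that c by (simp add: pw field_simps)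
    then have "real_of_int k < log 2 (y / c)" using y0 c by (simp add: less_log_iff)
    then show ?thesis unfolding j_def by linarith
  qed
  have "(\<integral>\<^sup>+k. ennreal (c * 2 powi k) * indicator {k. c * 2 powi k < y} k \<partial>count_space (UNIV::int set))
      \<le> (\<integral>\<^sup>+k. ennreal (c * 2 powi k) * indicator {..j} k \<partial>count_space (UNIV::int set))"
    using sub by (intro nn_integral_mono) (auto simp: indicator_def)
  also have "\<dots> = (\<integral>\<^sup>+k. ennreal (c * 2 powi k) \<partial>count_space {..j})"
    by (simp add: nn_integral_count_space_indicator)
  also have "\<dots> = (\<integral>\<^sup>+i. ennreal (c * 2 powi (j - int i)) \<partial>count_space (UNIV::nat set))"
  proof (rule nn_integral_bij_count_space[symmetric])
    show "bij_betw (\<lambda>i. j - int i) UNIV {..j}"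
      by (rule bij_betwI[where g = "\<lambda>k. nat (j - k)"]) auto
  qed
  also have "\<dots> = (\<Sum>i. ennreal (c * 2 powi j * (1/2) ^ i))"
    by (simp add: nn_integral_count_space_nat power_int_diff field_simps)
  also have "\<dots> = ennreal (c * 2 powi j * 2)"
  proof (rule suminf_ennreal_eq)
    show "(\<lambda>i. c * 2 powi j * (1 / 2) ^ i) sums (c * 2 powi j * 2)"
      using geometric_sums[of "1/2::real"] by (intro sums_mult) simp
  qed (use c in simp)
  also have "\<dots> \<le> ennreal (2 * y)"
    using j by (intro ennreal_leI) simp
  finally show ?thesis .
qed

lemma epowr_ennreal_neg:
  assumes "0 \<le> a" "0 < u"
  shows "epowr (ennreal a) (- u) = (if a = 0 then \<infinity> else ennreal (a powr (- u)))"
  using assms by (auto simp: epowr_def)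

text \<open>The convex function z^(-q) lies above its tangent at \<open>c\<close>. The negative
  linear term is moved to the right side, so that all terms are nonnegative and the inequality can
  be integrated in \<open>ennreal\<close>.\<close>

lemma tangent_powr:
  fixes x c q :: real
  assumes x: "0 < x" and c: "0 < c" and q: "0 < q"
  shows "(1 + q) * c powr (- q) \<le> x powr (- q) + q * c powr (- q) / c * x"
proof -
  have "ln (x / c) \<le> x / c - 1"
    using x c by (intro ln_le_minus_one) simp
  then have "q * ln (x / c) \<le> q * (x / c - 1)"
    using q by (intro mult_left_mono) auto
  moreover have "1 + (- q * ln (x / c)) \<le> exp (- q * ln (x / c))"
    by (rule exp_ge_add_one_self)
  moreover have "exp (- q * ln (x / c)) = (x / c) powr (- q)"
    using x c by (simp add: powr_def)
  ultimately have "1 + q \<le> (x / c) powr (- q) + q * (x / c)"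
    by (simp add: algebra_simps)
  then have "c powr (- q) * (1 + q) \<le> c powr (- q) * ((x / c) powr (- q) + q * (x / c))"
    by (intro mult_left_mono) auto
  also have "\<dots> = x powr (- q) + q * c powr (- q) / c * x"
    using x c by (simp add: powr_divide field_simps powr_minus)
  finally show ?thesis by (simp add: mult.commute)
qed

section \<open>Weights with an A_p condition on a laminar family\<close>

text \<open>The assumption \<open>dual\<close> is the A_p condition solved for the dual average: if
  \<open>b\<close> is a lower bound for the average of \<open>v\<close> over \<open>Q\<close>, then
  the average of v^(-u) is at most (K/b)^u. For u = 1/(p-1) and \<open>b\<close> equal to the
  average of \<open>v\<close>, this is the usual bound of the product by \<open>K\<close>. In this
  form p = 1 and p > 1 are treated alike.\<close>

locale weighted_family = laminar_family M D for M :: "'a measure" and D +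
  fixes v :: "'a \<Rightarrow> real" and K u :: real
  assumes v_measurable[measurable]: "v \<in> borel_measurable M"
    and v_nonneg: "0 \<le> v x"
    and K_pos: "0 < K" and u_pos: "0 < u"
    and emeasure_family_finite: "Q \<in> D \<Longrightarrow> emeasure M Q < \<infinity>"
    and weight_finite: "Q \<in> D \<Longrightarrow> emeasure (density M (\<lambda>x. ennreal (v x))) Q < \<infinity>"
    and dual: "\<lbrakk>Q \<in> D; 0 < b;
        ennreal b * emeasure M Q \<le> emeasure (density M (\<lambda>x. ennreal (v x))) Q\<rbrakk>
      \<Longrightarrow> (\<integral>\<^sup>+x\<in>Q. epowr (ennreal (v x)) (- u) \<partial>M) \<le> ennreal ((K / b) powr u) * emeasure M Q"
begin

abbreviation "N \<equiv> density M (\<lambda>x. ennreal (v x))"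

lemma epowr_v: "epowr (ennreal (v x)) (- u) = (if v x = 0 then \<infinity> else ennreal (v x powr (- u)))"
  using v_nonneg u_pos by (simp add: epowr_ennreal_neg)

text \<open>Chebyshev's inequality for v^(-u), which is at least a^(-u) where v \<le> a. Zeros of
  \<open>v\<close> are covered, since \<open>epowr\<close> is infinite there.\<close>

lemma emeasure_sublevel_le:
  assumes Q: "Q \<in> D" and a: "0 < a" and b: "0 < b" and le: "ennreal b * emeasure M Q \<le> emeasure N Q"
  shows "emeasure M ({x \<in> space M. v x \<le> a} \<inter> Q) \<le> ennreal ((K * a / b) powr u) * emeasure M Q"
proof -
  have [measurable]: "Q \<in> sets M" using Q by (rule sets_family)
  have "ennreal (a powr (- u)) * emeasure M ({x \<in> space M. v x \<le> a} \<inter> Q)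
      = (\<integral>\<^sup>+x. ennreal (a powr (- u)) * indicator ({x \<in> space M. v x \<le> a} \<inter> Q) x \<partial>M)"
    by (subst nn_integral_cmult_indicator) auto
  also have "\<dots> \<le> (\<integral>\<^sup>+x\<in>Q. epowr (ennreal (v x)) (- u) \<partial>M)"
  proof (intro nn_integral_mono)
    fix x
    show "ennreal (a powr (- u)) * indicator ({x \<in> space M. v x \<le> a} \<inter> Q) x
        \<le> epowr (ennreal (v x)) (- u) * indicator Q x"
      using v_nonneg[of x] a u_pos
      by (auto simp: epowr_v indicator_def intro!: ennreal_leI powr_mono2')
  qed
  also have "\<dots> \<le> ennreal ((K / b) powr u) * emeasure M Q"
    using dual Q b le by blast
  finally have "ennreal (a powr u) * (ennreal (a powr (- u)) * emeasure M ({x \<in> space M. v x \<le> a} \<inter> Q))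
      \<le> ennreal (a powr u) * (ennreal ((K / b) powr u) * emeasure M Q)"
    by (intro mult_left_mono) auto
  moreover have "ennreal (a powr u) * ennreal (a powr (- u)) = 1"
    using a by (simp flip: ennreal_mult powr_add)
  moreover have "ennreal (a powr u) * ennreal ((K / b) powr u) = ennreal ((K * a / b) powr u)"
    using a b K_pos by (simp add: powr_mult powr_divide field_simps flip: ennreal_mult)
  ultimately show ?thesis by (simp flip: mult.assoc)
qed

text \<open>Integrating the tangent inequality of \<open>z \<mapsto> z\<^sup>-\<^sup>2\<^sup>u\<close> at \<open>\<surd>(b/K)\<close> replaces Jensen's inequality.\<close>

lemma emeasure_le_sqrt_integral:
  assumes Q: "Q \<in> D" and b: "0 < b" and le: "ennreal b * emeasure M Q \<le> emeasure N Q"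
  shows "ennreal (sqrt (b / K)) * emeasure M Q \<le> (\<integral>\<^sup>+x\<in>Q. ennreal (sqrt (v x)) \<partial>M)"
proof -
  have [measurable]: "Q \<in> sets M" using Q by (rule sets_family)
  \<comment> \<open>The exponent \<open>q\<close> turns powers of \<surd>v into powers of
    \<open>v\<close>, and \<open>c\<close> makes c^(-q) equal to the constant (K/b)^u of
    \<open>dual\<close>.\<close>
  define c where "c = sqrt (b / K)"
  define q where "q = 2 * u"
  have c: "0 < c" and q: "0 < q" using b K_pos u_pos by (auto simp: c_def q_def)
  have sqrt_powr: "sqrt y powr (- q) = y powr (- u)" if "0 \<le> y" for y
    using that by (simp add: q_def powr_half_sqrt[symmetric] powr_powr)
  have cq: "c powr (- q) = (K / b) powr u"
    unfolding c_def using b K_pos by (subst sqrt_powr) (auto simp: powr_minus powr_divide)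
  define C where "C = c powr (- q)"
  have C: "0 < C" using c by (simp add: C_def)
  let ?I = "\<integral>\<^sup>+x\<in>Q. ennreal (sqrt (v x)) \<partial>M"
  \<comment> \<open>The left side of the tangent inequality is split so that its first summand
    cancels against the bound from \<open>dual\<close>; the measure of \<open>Q\<close> is finite,
    so the cancellation is legitimate.\<close>
  have "ennreal C * emeasure M Q + ennreal (q * C) * emeasure M Q = ennreal ((1 + q) * C) * emeasure M Q"
    using C q by (simp add: ring_distribs(2)[symmetric] flip: ennreal_plus) (simp add: algebra_simps)
  also have "\<dots> = (\<integral>\<^sup>+x. ennreal ((1 + q) * C) * indicator Q x \<partial>M)"
    by (subst nn_integral_cmult_indicator) auto
  also have "\<dots> \<le> (\<integral>\<^sup>+x. epowr (ennreal (v x)) (- u) * indicator Q x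
      + ennreal (q * C / c) * (ennreal (sqrt (v x)) * indicator Q x) \<partial>M)"
  proof (intro nn_integral_mono)
    fix x
    have "ennreal ((1 + q) * C) \<le> epowr (ennreal (v x)) (- u) + ennreal (q * C / c) * ennreal (sqrt (v x))"
    proof (cases "v x = 0")
      case True
      then show ?thesis using epowr_v[of x] by simp
    next
      case False
      then have vx: "0 < v x" using v_nonneg[of x] by simp
      have "(1 + q) * C \<le> v x powr (- u) + q * C / c * sqrt (v x)"
        using tangent_powr[of "sqrt (v x)" c q] vx c q sqrt_powr[of "v x"] by (simp add: C_def)
      then have "ennreal ((1 + q) * C) \<le> ennreal (v x powr (- u) + q * C / c * sqrt (v x))"
        by (rule ennreal_leI)
      also have "\<dots> = epowr (ennreal (v x)) (- u) + ennreal (q * C / c) * ennreal (sqrt (v x))"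
        using vx c q C by (subst ennreal_plus) (auto simp: epowr_v simp flip: ennreal_mult)
      finally show ?thesis .
    qed
    then show "ennreal ((1 + q) * C) * indicator Q x \<le> epowr (ennreal (v x)) (- u) * indicator Q x
        + ennreal (q * C / c) * (ennreal (sqrt (v x)) * indicator Q x)"
      by (auto simp: indicator_def)
  qed
  also have "\<dots> = (\<integral>\<^sup>+x\<in>Q. epowr (ennreal (v x)) (- u) \<partial>M) + ennreal (q * C / c) * ?I"
    unfolding epowr_v by (subst nn_integral_add) (auto simp: nn_integral_cmult)
  also have "\<dots> \<le> ennreal C * emeasure M Q + ennreal (q * C / c) * ?I"
    using dual[OF Q b le] cq by (intro add_mono) (auto simp: C_def)
  finally have "ennreal (q * C) * emeasure M Q \<le> ennreal (q * C / c) * ?I"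
    using emeasure_family_finite[OF Q] by (subst (asm) ennreal_add_left_cancel_le) (auto simp: ennreal_mult_eq_top_iff)
  then have "ennreal (c / (q * C)) * (ennreal (q * C) * emeasure M Q)
      \<le> ennreal (c / (q * C)) * (ennreal (q * C / c) * ?I)"
    by (intro mult_left_mono) auto
  moreover have "ennreal (c / (q * C)) * ennreal (q * C) = ennreal c"
    "ennreal (c / (q * C)) * ennreal (q * C / c) = 1"
    using c q C by (simp_all flip: ennreal_mult)
  ultimately show ?thesis by (simp add: c_def flip: mult.assoc)
qed

section \<open>The maximal function of the weight inside a fixed member\<close>

definition superlevel :: "'a set \<Rightarrow> real \<Rightarrow> 'a set" where
  "superlevel P b = \<Union>{Q \<in> D. Q \<subseteq> P \<and> ennreal b * emeasure M Q \<le> emeasure N Q}"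

lemma sets_superlevel[measurable]: "superlevel P b \<in> sets M"
  unfolding superlevel_def by (rule sets_Union_family) auto

lemma superlevel_subset: "superlevel P b \<subseteq> P"
  unfolding superlevel_def by auto

text \<open>The set \<open>superlevel P b\<close> consists of the points where some average of
  \<open>v\<close> inside \<open>P\<close> reaches \<open>b\<close>. Over such a member \<surd>v has
  average at least 2l; the part where \<surd>v \<le> l accounts for at most l, so the part above
  \<open>l\<close> accounts for at least l. Summing over maximal members and using b = 4 K l^2 gives
  the claim, the truncated weak type estimate behind the L^2 maximal inequality.\<close>

lemma emeasure_superlevel_le:
  assumes b: "0 < b" and P: "P \<in> D"
  defines "l \<equiv> sqrt (b / K) / 2"
  shows "ennreal b * emeasure M (superlevel P b)
    \<le> (\<integral>\<^sup>+x\<in>P. ennreal (4 * K * l * sqrt (v x)) * indicator {x. l < sqrt (v x)} x \<partial>M)"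
proof -
  have [measurable]: "P \<in> sets M" using P by (rule sets_family)
  have l: "0 < l" using b K_pos by (simp add: l_def)
  have bl: "b = 4 * K * l * l"
    using b K_pos by (simp add: l_def)
  define H where "H = density M (\<lambda>x. ennreal (sqrt (v x)))"
  define Y where "Y = {x \<in> space M. l < sqrt (v x)}"
  have Y[measurable]: "Y \<in> sets M" unfolding Y_def by measurable
  have H: "emeasure H A = (\<integral>\<^sup>+x\<in>A. ennreal (sqrt (v x)) \<partial>M)" if "A \<in> sets M" for A
    using that unfolding H_def by (subst emeasure_density) auto
  let ?F = "{Q \<in> D. Q \<subseteq> P \<and> ennreal b * emeasure M Q \<le> emeasure N Q}"
  have "emeasure M (space M \<inter> \<Union>?F) \<le> ennreal (1 / l) * emeasure H (Y \<inter> \<Union>?F)"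
  proof (rule emeasure_Union_le)
    fix Q assume "Q \<in> ?F"
    then have Q: "Q \<in> D" and le: "ennreal b * emeasure M Q \<le> emeasure N Q" by auto
    have [measurable]: "Q \<in> sets M" using Q by (rule sets_family)
    have "ennreal l * emeasure M Q + ennreal l * emeasure M Q = ennreal (sqrt (b / K)) * emeasure M Q"
      using l by (simp add: l_def flip: distrib_right ennreal_plus)
    also have "\<dots> \<le> (\<integral>\<^sup>+x\<in>Q. ennreal (sqrt (v x)) \<partial>M)"
      using Q b le by (rule emeasure_le_sqrt_integral)
    also have "\<dots> \<le> (\<integral>\<^sup>+x. ennreal l * indicator Q x + ennreal (sqrt (v x)) * indicator (Y \<inter> Q) x \<partial>M)"
      by (intro nn_integral_mono) (auto simp: indicator_def Y_def intro!: ennreal_leI)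
    also have "\<dots> = ennreal l * emeasure M Q + emeasure H (Y \<inter> Q)"
      by (subst nn_integral_add) (auto simp: nn_integral_cmult_indicator H)
    finally have "ennreal l * emeasure M Q \<le> emeasure H (Y \<inter> Q)"
      using emeasure_family_finite[OF Q] by (subst (asm) ennreal_add_left_cancel_le) (auto simp: ennreal_mult_eq_top_iff)
    then have "ennreal (1 / l) * (ennreal l * emeasure M Q) \<le> ennreal (1 / l) * emeasure H (Y \<inter> Q)"
      by (intro mult_left_mono) auto
    moreover have "ennreal (1 / l) * ennreal l = 1" using l by (simp flip: ennreal_mult)
    moreover have "space M \<inter> Q = Q" using sets.sets_into_space[of Q M] by auto
    ultimately show "emeasure M (space M \<inter> Q) \<le> ennreal (1 / l) * emeasure H (Y \<inter> Q)"
      by (simp flip: mult.assoc)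
  qed (auto simp: H_def)
  moreover have "space M \<inter> superlevel P b = superlevel P b"
    using sets.sets_into_space[OF sets_superlevel] by auto
  ultimately have "emeasure M (superlevel P b) \<le> ennreal (1 / l) * emeasure H (Y \<inter> superlevel P b)"
    by (simp add: superlevel_def)
  also have "\<dots> \<le> ennreal (1 / l) * emeasure H (Y \<inter> P)"
    using superlevel_subset[of P b] by (intro mult_left_mono emeasure_mono) (auto simp: H_def)
  finally have "ennreal b * emeasure M (superlevel P b)
      \<le> ennreal b * (ennreal (1 / l) * emeasure H (Y \<inter> P))"
    by (intro mult_left_mono) auto
  also have "\<dots> = ennreal (4 * K * l) * emeasure H (Y \<inter> P)"
    using l b K_pos by (intro ennreal_mult_mult) (auto simp: bl)
  also have "\<dots> = (\<integral>\<^sup>+x. ennreal (4 * K * l) * (ennreal (sqrt (v x)) * indicator (Y \<inter> P) x) \<partial>M)"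
    by (subst H) (auto simp: nn_integral_cmult)
  also have "\<dots> = (\<integral>\<^sup>+x\<in>P. ennreal (4 * K * l * sqrt (v x)) * indicator {x. l < sqrt (v x)} x \<partial>M)"
    using l K_pos v_nonneg
    by (intro nn_integral_cong) (auto simp: indicator_def Y_def ennreal_mult)
  finally show ?thesis .
qed

text \<open>A discrete layer-cake form of the bound of the integral of the maximal function of
  \<open>v\<close> over \<open>P\<close> by a multiple of K v(P). After exchanging sum and integral,
  the thresholds below \<surd>v(x) form a geometric sum of size at most 2 \<surd>v(x), and the other
  factor \<surd>v(x) restores \<open>v\<close>.\<close>

lemma sum_superlevel_le:
  assumes \<beta>: "0 < \<beta>" and P: "P \<in> D"
  shows "(\<integral>\<^sup>+k. ennreal (\<beta> * 4 powi k) * emeasure M (superlevel P (\<beta> * 4 powi k)) \<partial>count_space (UNIV::int set))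
    \<le> ennreal (8 * K) * emeasure N P"
proof -
  have [measurable]: "P \<in> sets M" using P by (rule sets_family)
  \<comment> \<open>The threshold \<open>l\<close> of \<open>emeasure_superlevel_le\<close> at k =
    0. Levels grow by 4, so thresholds grow by 2.\<close>
  define c where "c = sqrt (\<beta> / K) / 2"
  have c: "0 < c" using \<beta> K_pos by (simp add: c_def)
  have pw4: "(4::real) powi k = (2 powi k)\<^sup>2" for k :: int
    by (simp add: power2_eq_square flip: power_int_mult_distrib)
  have l: "sqrt (\<beta> * 4 powi k / K) / 2 = c * 2 powi k" for k :: int
    by (simp add: pw4 c_def real_sqrt_mult real_sqrt_divide)
  have "(\<integral>\<^sup>+k. ennreal (\<beta> * 4 powi k) * emeasure M (superlevel P (\<beta> * 4 powi k)) \<partial>count_space (UNIV::int set))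
    \<le> (\<integral>\<^sup>+k. (\<integral>\<^sup>+x\<in>P. ennreal (4 * K * (c * 2 powi k) * sqrt (v x))
          * indicator {x. c * 2 powi k < sqrt (v x)} x \<partial>M) \<partial>count_space (UNIV::int set))"
    using \<beta> emeasure_superlevel_le[OF _ P] by (intro nn_integral_mono) (simp flip: l)
  also have "\<dots> = (\<integral>\<^sup>+x. (\<integral>\<^sup>+k. ennreal (4 * K * (c * 2 powi k) * sqrt (v x))
          * indicator {x. c * 2 powi k < sqrt (v x)} x * indicator P x \<partial>count_space (UNIV::int set)) \<partial>M)"
    by (rule nn_integral_count_space_nn_integral[symmetric]) auto
  also have "\<dots> \<le> (\<integral>\<^sup>+x. ennreal (8 * K) * (ennreal (v x) * indicator P x) \<partial>M)"
  proof (intro nn_integral_mono)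
    fix x
    have "(\<integral>\<^sup>+k. ennreal (4 * K * (c * 2 powi k) * sqrt (v x))
          * indicator {x. c * 2 powi k < sqrt (v x)} x * indicator P x \<partial>count_space (UNIV::int set))
      = (\<integral>\<^sup>+k. (ennreal (4 * K * sqrt (v x)) * indicator P x) * (ennreal (c * 2 powi k)
          * indicator {k. c * 2 powi k < sqrt (v x)} k) \<partial>count_space (UNIV::int set))"
      using K_pos c v_nonneg[of x]
      by (intro nn_integral_cong) (auto simp: indicator_def mult_ac simp flip: ennreal_mult)
    also have "\<dots> \<le> (ennreal (4 * K * sqrt (v x)) * indicator P x) * ennreal (2 * sqrt (v x))"
      using nn_integral_geometric_below[OF c, of "sqrt (v x)"] v_nonneg[of x]
      by (subst nn_integral_cmult) (auto intro: mult_left_mono)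
    also have "\<dots> = ennreal (8 * K) * (ennreal (v x) * indicator P x)"
      using K_pos v_nonneg[of x] by (auto simp: indicator_def simp flip: ennreal_mult)
    finally show "(\<integral>\<^sup>+k. ennreal (4 * K * (c * 2 powi k) * sqrt (v x))
          * indicator {x. c * 2 powi k < sqrt (v x)} x * indicator P x \<partial>count_space (UNIV::int set))
      \<le> ennreal (8 * K) * (ennreal (v x) * indicator P x)" .
  qed
  also have "\<dots> = ennreal (8 * K) * emeasure N P"
    by (subst emeasure_density) (auto simp: nn_integral_cmult)
  finally show ?thesis .
qed

section \<open>The part of a member where the weight is small against its maximal function\<close>

lemma density_weight_le_levels:
  assumes [measurable]: "A \<in> sets M"
  shows "emeasure N A \<le> (\<integral>\<^sup>+k. ennreal (4 * 4 powi k) *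
    emeasure M ({x \<in> space M. 4 powi k < v x \<and> v x \<le> 4 * 4 powi k} \<inter> A) \<partial>count_space (UNIV::int set))"
proof -
  define L where "L = (\<lambda>k::int. {x \<in> space M. 4 powi k < v x \<and> v x \<le> 4 * 4 powi k})"
  have [measurable]: "L k \<in> sets M" for k unfolding L_def by measurable
  have "emeasure N A = (\<integral>\<^sup>+x. ennreal (v x) * indicator A x \<partial>M)"
    by (subst emeasure_density) auto
  also have "\<dots> \<le> (\<integral>\<^sup>+x. (\<integral>\<^sup>+k. ennreal (4 * 4 powi k) * indicator (L k \<inter> A) x \<partial>count_space (UNIV::int set)) \<partial>M)"
  proof (intro nn_integral_mono)
    fix x assume x: "x \<in> space M"
    show "ennreal (v x) * indicator A x
      \<le> (\<integral>\<^sup>+k. ennreal (4 * 4 powi k) * indicator (L k \<inter> A) x \<partial>count_space (UNIV::int set))"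
    proof (cases "v x = 0 \<or> x \<notin> A")
      case False
      then have vx: "0 < v x" and xA: "x \<in> A" using v_nonneg[of x] by auto
      \<comment> \<open>The layers are open below and closed above, hence the ceiling minus
        one.\<close>
      define j where "j = \<lceil>log 4 (v x)\<rceil> - 1"
      have pw: "4 powi k = 4 powr real_of_int k" for k :: int
        by (simp add: powr_real_of_int')
      have "real_of_int j < log 4 (v x)" "log 4 (v x) \<le> real_of_int (j + 1)"
        unfolding j_def by linarith+
      then have "4 powr real_of_int j < v x" "v x \<le> 4 powr real_of_int (j + 1)"
        using vx by (auto simp: less_log_iff log_le_iff)
      then have j: "4 powi j < v x" "v x \<le> 4 * 4 powi j"
        by (auto simp: pw powr_add)
      have "ennreal (v x) * indicator A x \<le> ennreal (4 * 4 powi j) * indicator (L j \<inter> A) x"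
        using j x xA by (simp add: L_def ennreal_leI)
      also have "\<dots> = (\<integral>\<^sup>+k. ennreal (4 * 4 powi j) * indicator (L j \<inter> A) x * indicator {j} k \<partial>count_space UNIV)"
        by (subst nn_integral_cmult_indicator) auto
      also have "\<dots> \<le> (\<integral>\<^sup>+k. ennreal (4 * 4 powi k) * indicator (L k \<inter> A) x \<partial>count_space (UNIV::int set))"
        by (intro nn_integral_mono) (auto simp: indicator_def)
      finally show ?thesis .
    qed auto
  qed
  also have "\<dots> = (\<integral>\<^sup>+k. (\<integral>\<^sup>+x. ennreal (4 * 4 powi k) * indicator (L k \<inter> A) x \<partial>M) \<partial>count_space (UNIV::int set))"
    by (rule nn_integral_count_space_nn_integral) auto
  also have "\<dots> = (\<integral>\<^sup>+k. ennreal (4 * 4 powi k) * emeasure M (L k \<inter> A) \<partial>count_space (UNIV::int set))"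
    by (intro nn_integral_cong) (simp add: nn_integral_cmult_indicator)
  finally show ?thesis by (simp add: L_def)
qed

text \<open>The set where v \<le> s M_P v, with M_P the maximal operator over members inside
  \<open>P\<close>, written without division and with a member witnessing the bound.\<close>

definition small_part :: "real \<Rightarrow> 'a set \<Rightarrow> 'a set" where
  "small_part s P =
    {x. \<exists>Q\<in>D. x \<in> Q \<and> Q \<subseteq> P \<and> ennreal (v x) * emeasure M Q \<le> ennreal s * emeasure N Q}"

lemma sets_exists_family:
  assumes "\<And>Q. Q \<in> D \<Longrightarrow> {x \<in> space M. R Q x} \<in> sets M"
  shows "{x. \<exists>Q\<in>D. x \<in> Q \<and> R Q x} \<in> sets M"
proof -
  have "{x. \<exists>Q\<in>D. x \<in> Q \<and> R Q x} = (\<Union>Q\<in>D. {x \<in> space M. R Q x} \<inter> Q)"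
    using sets.sets_into_space[OF sets_family] by auto
  also have "\<dots> \<in> sets M"
    using assms sets_family countable_family by (intro sets.countable_UN') auto
  finally show ?thesis .
qed

lemma sets_small_part[measurable]: "small_part s P \<in> sets M"
  unfolding small_part_def by (rule sets_exists_family) measurable

text \<open>On the layer where \<open>v\<close> is between 4^k and 4 * 4^k, a witness for
  \<open>small_part\<close> has average at least b = 4^k / s. By \<open>emeasure_sublevel_le\<close>
  with a = 4 * 4^k, the layer fills at most the proportion (K a / b)^u = (4 K s)^u of each maximal
  member of \<open>superlevel P b\<close>. This proportion does not depend on \<open>k\<close>, so
  \<open>sum_superlevel_le\<close> with \<beta> = 1/s adds up the layers.\<close>

lemma small_part_le:
  assumes s: "0 < s" and P: "P \<in> D"
  shows "emeasure N (small_part s P) \<le> ennreal (32 * K * s * (4 * K * s) powr u) * emeasure N P"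
proof -
  have "emeasure N (small_part s P) \<le> (\<integral>\<^sup>+k. ennreal (4 * 4 powi k) *
      emeasure M ({x \<in> space M. 4 powi k < v x \<and> v x \<le> 4 * 4 powi k} \<inter> small_part s P) \<partial>count_space (UNIV::int set))"
    by (rule density_weight_le_levels) simp
  also have "\<dots> \<le> (\<integral>\<^sup>+k. ennreal (4 * s * (4 * K * s) powr u) *
      (ennreal (1 / s * 4 powi k) * emeasure M (superlevel P (1 / s * 4 powi k))) \<partial>count_space (UNIV::int set))"
  proof (intro nn_integral_mono)
    fix k :: int
    define b where "b = 1 / s * 4 powi k"
    define a where "a = 4 * (4::real) powi k"
    have b: "0 < b" and a: "0 < a" using s by (auto simp: b_def a_def)
    define A where "A = {x \<in> space M. v x \<le> a}"
    have A[measurable]: "A \<in> sets M" unfolding A_def by measurable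
    have "{x \<in> space M. 4 powi k < v x \<and> v x \<le> 4 * 4 powi k} \<inter> small_part s P \<subseteq> A \<inter> superlevel P b"
    proof
      fix x assume "x \<in> {x \<in> space M. 4 powi k < v x \<and> v x \<le> 4 * 4 powi k} \<inter> small_part s P"
      then obtain Q where x: "x \<in> space M" "4 powi k < v x" "v x \<le> a" "x \<in> Q" and Q: "Q \<in> D" "Q \<subseteq> P"
        and le: "ennreal (v x) * emeasure M Q \<le> ennreal s * emeasure N Q"
        by (auto simp: small_part_def a_def)
      have "ennreal b * emeasure M Q \<le> ennreal (v x / s) * emeasure M Q"
        using x s by (intro mult_right_mono ennreal_leI) (auto simp: b_def field_simps)
      also have "\<dots> = ennreal (1 / s) * (ennreal (v x) * emeasure M Q)"
        using s v_nonneg[of x] by (intro ennreal_mult_mult[symmetric]) auto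
      also have "\<dots> \<le> ennreal (1 / s) * (ennreal s * emeasure N Q)"
        by (intro mult_left_mono le) auto
      also have "\<dots> = emeasure N Q"
        using s by (subst ennreal_mult_mult[where c = 1]) auto
      finally show "x \<in> A \<inter> superlevel P b"
        using x Q by (auto simp: superlevel_def A_def)
    qed
    then have "emeasure M ({x \<in> space M. 4 powi k < v x \<and> v x \<le> 4 * 4 powi k} \<inter> small_part s P)
        \<le> emeasure M (A \<inter> superlevel P b)"
      by (intro emeasure_mono) auto
    also have "\<dots> \<le> ennreal ((4 * K * s) powr u) * emeasure M (space M \<inter> superlevel P b)"
      unfolding superlevel_def
    proof (rule emeasure_Union_le)
      fix Q assume Q: "Q \<in> {Q \<in> D. Q \<subseteq> P \<and> ennreal b * emeasure M Q \<le> emeasure N Q}"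
      have "K * a / b = 4 * K * s"
        using s by (simp add: a_def b_def)
      moreover have "space M \<inter> Q = Q"
        using Q sets.sets_into_space[OF sets_family] by auto
      ultimately show "emeasure M (A \<inter> Q) \<le> ennreal ((4 * K * s) powr u) * emeasure M (space M \<inter> Q)"
        using emeasure_sublevel_le[of Q a b] Q a b by (simp add: A_def)
    qed auto
    also have "space M \<inter> superlevel P b = superlevel P b"
      using sets.sets_into_space[OF sets_superlevel] by auto
    finally have "ennreal a * emeasure M ({x \<in> space M. 4 powi k < v x \<and> v x \<le> 4 * 4 powi k} \<inter> small_part s P)
        \<le> ennreal a * (ennreal ((4 * K * s) powr u) * emeasure M (superlevel P b))"
      by (intro mult_left_mono) auto
    also have "\<dots> = ennreal (a * (4 * K * s) powr u) * emeasure M (superlevel P b)"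
      using a by (intro ennreal_mult_mult) auto
    also have "\<dots> = ennreal (4 * s * (4 * K * s) powr u) * (ennreal b * emeasure M (superlevel P b))"
      using s b by (intro ennreal_mult_mult[symmetric]) (auto simp: a_def b_def)
    finally show "ennreal (4 * 4 powi k) *
        emeasure M ({x \<in> space M. 4 powi k < v x \<and> v x \<le> 4 * 4 powi k} \<inter> small_part s P)
      \<le> ennreal (4 * s * (4 * K * s) powr u) *
        (ennreal (1 / s * 4 powi k) * emeasure M (superlevel P (1 / s * 4 powi k)))"
      unfolding a_def b_def .
  qed
  also have "\<dots> = ennreal (4 * s * (4 * K * s) powr u) *
      (\<integral>\<^sup>+k. ennreal (1 / s * 4 powi k) * emeasure M (superlevel P (1 / s * 4 powi k)) \<partial>count_space (UNIV::int set))"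
    by (rule nn_integral_cmult) simp
  also have "\<dots> \<le> ennreal (4 * s * (4 * K * s) powr u) * (ennreal (8 * K) * emeasure N P)"
    using s by (intro mult_left_mono sum_superlevel_le P) auto
  also have "\<dots> = ennreal (32 * K * s * (4 * K * s) powr u) * emeasure N P"
    using s K_pos by (intro ennreal_mult_mult) auto
  finally show ?thesis .
qed

section \<open>Summation over the classes and the weak type estimate\<close>

lemma suminf_geometric_powr_le:
  "(\<Sum>i. ennreal (((1/4) ^ i) powr u)) \<le> ennreal (1 + 1 / u)"
proof -
  define r where "r = (1/4::real) powr u"
  have r: "0 < r" "r < 1" using u_pos powr_less_mono2[of u "1/4" 1] by (auto simp: r_def)
  \<comment> \<open>The inequality 1/r = 4^u \<ge> e^u \<ge> 1 + u keeps the ratio \<open>r\<close>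
    away from 1 and bounds the sum by 1 + 1/u, which equals p for u = 1/(p-1). This is where the
    linear dependence on p arises.\<close>
  have "1 + u \<le> exp u" by (rule exp_ge_add_one_self)
  also have "exp u \<le> 4 powr u"
  proof -
    have "exp (1::real) \<le> 4" using exp_le by simp
    then have "exp 1 powr u \<le> 4 powr u" using u_pos by (intro powr_mono2) auto
    then show ?thesis by (simp add: powr_def)
  qed
  also have "4 powr u = 1 / r" by (simp add: r_def powr_divide)
  finally have "(1 + u) * r \<le> 1" using r by (simp add: field_simps)
  then have "1 / (1 - r) \<le> 1 + 1 / u"
    using r u_pos by (simp add: field_simps)
  moreover have "(\<Sum>i. ennreal (((1/4) ^ i) powr u)) = ennreal (1 / (1 - r))"
  proof (rule suminf_ennreal_eq)
    have "((1/4) ^ i) powr u = r ^ i" for i :: nat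
      unfolding r_def by (induction i) (auto simp: powr_mult powr_divide)
    then show "(\<lambda>i. ((1/4) ^ i) powr u) sums (1 / (1 - r))"
      using geometric_sums[of r] r by simp
  qed simp
  ultimately show ?thesis by (simp add: ennreal_leI)
qed

text \<open>Members with v(Q) \<le> 4 K G(Q) contribute 4 K G(space), and class \<open>i\<close> of
  the others contributes 128 K 4^(-iu) G(space). Summing over \<open>i\<close> gives 4 K + 128 K (1
  + 1/u), at most 132 K (1 + 1/u).\<close>

lemma maximal_weak_type:
  assumes g[measurable]: "g \<in> borel_measurable M"
  defines "G \<equiv> density M g"
  shows "emeasure N {x. \<exists>Q\<in>D. x \<in> Q \<and> ennreal (v x) * emeasure M Q < emeasure G Q}
    \<le> ennreal (132 * K * (1 + 1 / u)) * emeasure G (space M)"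
proof -
  have [simp]: "sets G = sets M" by (simp add: G_def)
  have G_space: "emeasure G A \<le> emeasure G (space M)" for A
    using emeasure_space[of G A] by (simp add: G_def)
  define F where "F = {Q \<in> D. emeasure N Q \<le> ennreal (4 * K) * emeasure G Q}"
  define F' where "F' i = {Q \<in> D. ennreal (4 * K * 4 ^ i) * emeasure G Q \<le> emeasure N Q
      \<and> emeasure N Q \<le> ennreal (4 * (4 * K * 4 ^ i)) * emeasure G Q}" for i :: nat
  define E where "E i = {x. \<exists>Q\<in>D. x \<in> Q \<and> (Q \<in> F' i \<and> ennreal (v x) * emeasure M Q < emeasure G Q)}"
    for i :: nat
  have F: "F \<subseteq> D" "F' i \<subseteq> D" for i by (auto simp: F_def F'_def)
  have [measurable]: "E i \<in> sets M" for i
    unfolding E_def by (rule sets_exists_family) measurable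
  have [measurable]: "\<Union>F \<in> sets M" "\<Union>(F' i) \<in> sets M" for i
    using F by (auto intro: sets_Union_family)
  have space: "space M \<inter> Q = Q" if "Q \<in> D" for Q
    using that sets.sets_into_space[OF sets_family] by auto
  have "{x. \<exists>Q\<in>D. x \<in> Q \<and> ennreal (v x) * emeasure M Q < emeasure G Q} \<subseteq> \<Union>F \<union> (\<Union>i. E i)"
  proof
    fix x assume "x \<in> {x. \<exists>Q\<in>D. x \<in> Q \<and> ennreal (v x) * emeasure M Q < emeasure G Q}"
    then obtain Q where Q: "Q \<in> D" "x \<in> Q" and less: "ennreal (v x) * emeasure M Q < emeasure G Q" by auto
    show "x \<in> \<Union>F \<union> (\<Union>i. E i)"
    proof (cases "Q \<in> F")
      case False
      then have nle: "ennreal (4 * K) * emeasure G Q < emeasure N Q" using Q by (auto simp: F_def)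
      \<comment> \<open>An infinite value would put \<open>Q\<close> into \<open>F\<close>, and the
        value 0 contradicts the strict inequality \<open>less\<close>.\<close>
      have "emeasure G Q \<noteq> \<infinity>" "emeasure G Q \<noteq> 0"
        using nle less weight_finite[OF Q(1)] K_pos by (auto simp: ennreal_mult_eq_top_iff)
      then obtain y where y: "emeasure G Q = ennreal y" "0 < y"
        by (cases "emeasure G Q") (auto simp: less_le)
      obtain z where z: "emeasure N Q = ennreal z" "0 \<le> z"
        using weight_finite[OF Q(1)] by (cases "emeasure N Q") auto
      have nle': "4 * K * y < z"
        using nle y z K_pos by (simp add: ennreal_less_iff flip: ennreal_mult)
      \<comment> \<open>The class of \<open>Q\<close> is one less than the first index satisfying
        \<open>P\<close>; that index is a successor because \<open>P 0\<close> fails for members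
        outside \<open>F\<close>.\<close>
      define P where "P = (\<lambda>i::nat. z \<le> 4 * K * 4 ^ i * y)"
      have "\<exists>i. P i"
      proof -
        obtain i where "z / (4 * K * y) < 4 ^ i"
          using real_arch_pow[of "4::real"] by auto
        then have "P i" using y K_pos by (auto simp: P_def field_simps)
        then show ?thesis ..
      qed
      then have L: "P (LEAST i. P i)" by (rule LeastI_ex)
      moreover have "\<not> P 0" using nle' by (simp add: P_def)
      ultimately obtain i where i: "(LEAST i. P i) = Suc i" by (cases "LEAST i. P i") auto
      then have "\<not> P i" using not_less_Least[of i P] by simp
      then have "Q \<in> F' i"
        using L i Q y z K_pos by (auto simp: F'_def P_def simp flip: ennreal_mult intro!: ennreal_leI)
      then show ?thesis using Q less by (auto simp: E_def)
    qed (use Q in auto)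
  qed
  then have "emeasure N {x. \<exists>Q\<in>D. x \<in> Q \<and> ennreal (v x) * emeasure M Q < emeasure G Q}
      \<le> emeasure N (\<Union>F \<union> (\<Union>i. E i))"
    by (intro emeasure_mono) auto
  also have "\<dots> \<le> emeasure N (\<Union>F) + emeasure N (\<Union>i. E i)"
    by (intro emeasure_subadditive) auto
  also have "\<dots> \<le> ennreal (4 * K) * emeasure G (space M)
      + (\<Sum>i. ennreal (128 * K) * emeasure G (space M) * ennreal (((1/4) ^ i) powr u))"
  proof (intro add_mono)
    have "emeasure N (space M \<inter> \<Union>F) \<le> ennreal (4 * K) * emeasure G (space M \<inter> \<Union>F)"
      using F by (intro emeasure_Union_le) (auto simp: F_def space)
    also have "\<dots> \<le> ennreal (4 * K) * emeasure G (space M)"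
      by (intro mult_left_mono G_space) auto
    also have "space M \<inter> \<Union>F = \<Union>F"
      using sets.sets_into_space[OF sets_Union_family[OF F(1)]] by blast
    finally show "emeasure N (\<Union>F) \<le> ennreal (4 * K) * emeasure G (space M)" .
  next
    have "emeasure N (E i) \<le> ennreal (128 * K) * emeasure G (space M) * ennreal (((1/4) ^ i) powr u)" for i
    proof -
      define s where "s = 1 / (4 * K * 4 ^ i)"
      have s: "0 < s" using K_pos by (simp add: s_def)
      have Ks: "4 * K * s = (1/4) ^ i" using K_pos by (simp add: s_def power_divide)
      have "emeasure N (E i \<inter> \<Union>(F' i)) \<le> ennreal (128 * K * ((1/4) ^ i) powr u) * emeasure G (space M \<inter> \<Union>(F' i))"
      proof (rule emeasure_Union_le)
        fix P assume P: "P \<in> F' i" and maxi: "\<And>R. R \<in> F' i \<Longrightarrow> P \<subseteq> R \<Longrightarrow> R = P"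
        then have PD: "P \<in> D" by (simp add: F'_def)
        \<comment> \<open>A member of class \<open>i\<close> that meets the maximal \<open>P\<close>
          lies inside \<open>P\<close>. The lower bound of its class replaces G(Q) by s v(Q), which
          leaves a condition on \<open>v\<close> alone.\<close>
        have "E i \<inter> P \<subseteq> small_part s P"
        proof
          fix x assume "x \<in> E i \<inter> P"
          then obtain Q where Q: "Q \<in> F' i" "x \<in> Q" "x \<in> P"
            and less: "ennreal (v x) * emeasure M Q < emeasure G Q"
            by (auto simp: E_def)
          have QD: "Q \<in> D" using Q by (simp add: F'_def)
          have "Q \<subseteq> P" using laminar[OF QD PD] Q maxi[of Q] by auto
          have "emeasure G Q = ennreal s * (ennreal (4 * K * 4 ^ i) * emeasure G Q)"
            using K_pos by (subst ennreal_mult_mult[where c = 1]) (auto simp: s_def)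
          also have "\<dots> \<le> ennreal s * emeasure N Q"
            using Q by (intro mult_left_mono) (auto simp: F'_def)
          finally have "ennreal (v x) * emeasure M Q \<le> ennreal s * emeasure N Q"
            using less by auto
          with QD Q \<open>Q \<subseteq> P\<close> show "x \<in> small_part s P" by (auto simp: small_part_def)
        qed
        then have "emeasure N (E i \<inter> P) \<le> emeasure N (small_part s P)"
          by (intro emeasure_mono) auto
        also have "\<dots> \<le> ennreal (32 * K * s * (4 * K * s) powr u) * emeasure N P"
          by (rule small_part_le[OF s PD])
        \<comment> \<open>The upper bound of the class is v(P) \<le> (4/s) G(P). The factor 1/s
          cancels the gain \<open>s\<close> of \<open>small_part_le\<close>, and only the decay (4 K
          s)^u = 4^(-iu) remains.\<close>
        also have "\<dots> \<le> ennreal (32 * K * s * (4 * K * s) powr u)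
            * (ennreal (4 * (4 * K * 4 ^ i)) * emeasure G P)"
          using P by (intro mult_left_mono) (auto simp: F'_def)
        also have "\<dots> = ennreal (32 * K * s * (4 * K * s) powr u * (4 / s)) * emeasure G P"
          using s K_pos by (intro ennreal_mult_mult) (auto simp: s_def)
        also have "32 * K * s * (4 * K * s) powr u * (4 / s) = 128 * K * ((1/4) ^ i) powr u"
          using s by (simp add: Ks)
        finally show "emeasure N (E i \<inter> P) \<le> ennreal (128 * K * ((1/4) ^ i) powr u) * emeasure G (space M \<inter> P)"
          by (simp add: space[OF PD])
      qed (use F in auto)
      also have "E i \<inter> \<Union>(F' i) = E i" by (auto simp: E_def)
      also have "ennreal (128 * K * ((1/4) ^ i) powr u) * emeasure G (space M \<inter> \<Union>(F' i))
          \<le> ennreal (128 * K * ((1/4) ^ i) powr u) * emeasure G (space M)"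
        by (intro mult_left_mono G_space) auto
      also have "\<dots> = ennreal (128 * K) * emeasure G (space M) * ennreal (((1/4) ^ i) powr u)"
        using K_pos by (simp add: ennreal_mult mult_ac)
      finally show ?thesis .
    qed
    then show "emeasure N (\<Union>i. E i) \<le> (\<Sum>i. ennreal (128 * K) * emeasure G (space M) * ennreal (((1/4) ^ i) powr u))"
      by (intro order_trans[OF emeasure_subadditive_countably] suminf_le) auto
  qed
  also have "\<dots> = ennreal (4 * K) * emeasure G (space M)
      + ennreal (128 * K) * emeasure G (space M) * (\<Sum>i. ennreal (((1/4) ^ i) powr u))"
    by simp
  also have "\<dots> \<le> ennreal (4 * K) * emeasure G (space M)
      + ennreal (128 * K) * emeasure G (space M) * ennreal (1 + 1 / u)"
    by (intro add_left_mono mult_left_mono suminf_geometric_powr_le) auto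
  also have "\<dots> = ennreal (4 * K + 128 * K * (1 + 1 / u)) * emeasure G (space M)"
  proof -
    define w where "w = 1 + 1 / u"
    have "0 < w" using u_pos by (simp add: w_def add_pos_pos)
    then show ?thesis
      unfolding w_def[symmetric] using K_pos
      by (subst ennreal_plus) (auto simp: ennreal_mult distrib_left distrib_right mult_ac)
  qed
  also have "\<dots> \<le> ennreal (132 * K * (1 + 1 / u)) * emeasure G (space M)"
    using K_pos u_pos by (intro mult_right_mono ennreal_leI) (auto simp: field_simps)
  finally show ?thesis .
qed

end


section \<open>The dyadic grid as a laminar family\<close>

definition dyadic_cube :: "int \<Rightarrow> ('n \<Rightarrow> int) \<Rightarrow> (real ^ 'n::finite) set" where
  "dyadic_cube k m = {x. \<forall>i. 2 powi k * of_int (m i) \<le> x $ i \<and> x $ i < 2 powi k * (of_int (m i) + 1)}"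

text \<open>The side length is capped because a cube of the full grid has infinitely many dyadic
  supersets, which would violate \<open>finite_supersets\<close>. The cap is removed at the end by
  letting \<open>N\<close> tend to infinity.\<close>

definition dyadic_upto :: "int \<Rightarrow> (real ^ 'n::finite) set set" where
  "dyadic_upto N = {dyadic_cube k m | k m. k \<le> N}"

lemma dyadic_cubes_eq: "dyadic_cubes = range (\<lambda>(k, m). dyadic_cube k m)"
  unfolding dyadic_cubes_def dyadic_cube_def by auto

lemma mem_dyadic_cube_iff: "x \<in> dyadic_cube k m \<longleftrightarrow> (\<forall>i. \<lfloor>x $ i / 2 powi k\<rfloor> = m i)"
  unfolding dyadic_cube_def by (auto simp: floor_eq_iff field_simps)

text \<open>The coarse index of a point is an integer quotient of its fine index, so points sharing
  a fine cube share the coarse one.\<close>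

lemma dyadic_cube_mono:
  fixes m m' :: "'n::finite \<Rightarrow> int"
  assumes "k \<le> k'" "x \<in> dyadic_cube k m" "x \<in> dyadic_cube k' m'"
  shows "dyadic_cube k m \<subseteq> dyadic_cube k' m'"
proof
  fix y :: "real ^ 'n" assume y: "y \<in> dyadic_cube k m"
  have *: "\<lfloor>z / 2 powi k'\<rfloor> = \<lfloor>z / 2 powi k\<rfloor> div 2 ^ nat (k' - k)" for z :: real
  proof -
    have "(2::real) powi k' = 2 powi k * 2 powi int (nat (k' - k))"
      using assms(1) by (subst power_int_add[symmetric]) auto
    then have "z / 2 powi k' = z / 2 powi k / real_of_int (2 ^ nat (k' - k))"
      by (simp add: power_int_def)
    then show ?thesis by (simp only: floor_divide_real_eq_div zero_le_power zero_le_numeral)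
  qed
  show "y \<in> dyadic_cube k' m'"
    using y assms(2,3) by (simp add: mem_dyadic_cube_iff *)
qed

lemma dyadic_cube_nonempty: "dyadic_cube k m \<noteq> {}"
proof -
  have "(\<chi> i. 2 powi k * of_int (m i)) \<in> dyadic_cube k m"
    by (auto simp: dyadic_cube_def)
  then show ?thesis by blast
qed

lemma dyadic_cube_borel: "dyadic_cube k m \<in> sets borel"
  unfolding dyadic_cube_def by measurable

lemma dyadic_cube_lebesgue: "dyadic_cube k m \<in> sets lebesgue"
  by (intro sets_completionI_sets) (simp add: dyadic_cube_borel)

lemma countable_dyadic_upto: "countable (dyadic_upto N :: (real ^ 'n::finite) set set)"
proof (rule countable_subset)
  show "dyadic_upto N \<subseteq> range (\<lambda>(k, m :: 'n \<Rightarrow> int). dyadic_cube k m)"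
    by (auto simp: dyadic_upto_def)
  show "countable (range (\<lambda>(k, m :: 'n \<Rightarrow> int). dyadic_cube k m))" by simp
qed

lemma laminar_family_dyadic_upto:
  "laminar_family lebesgue (dyadic_upto N :: (real ^ 'n::finite) set set)"
proof
  show "countable (dyadic_upto N :: (real ^ 'n) set set)" by (rule countable_dyadic_upto)
  show "Q \<in> sets lebesgue" if "Q \<in> dyadic_upto N" for Q :: "(real ^ 'n) set"
    using that by (auto simp: dyadic_upto_def dyadic_cube_lebesgue)
  show "Q \<inter> R = {} \<or> Q \<subseteq> R \<or> R \<subseteq> Q"
    if QR: "Q \<in> dyadic_upto N" "R \<in> dyadic_upto N" for Q R :: "(real ^ 'n) set"
  proof -
    obtain k m k' m' where "Q = dyadic_cube k m" "R = dyadic_cube k' m'"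
      using QR by (auto simp: dyadic_upto_def)
    then show ?thesis
      using dyadic_cube_mono[of k k' _ m m'] dyadic_cube_mono[of k' k _ m' m]
      by (cases "k \<le> k'") auto
  qed
  show "finite {R \<in> dyadic_upto N. Q \<subseteq> R}" if Q: "Q \<in> dyadic_upto N" for Q :: "(real ^ 'n) set"
  proof -
    obtain k m where Qk: "Q = dyadic_cube k m" "k \<le> N"
      using Q by (auto simp: dyadic_upto_def)
    obtain x where x: "x \<in> Q" using dyadic_cube_nonempty Qk by blast
    \<comment> \<open>\<open>C j\<close> is the only cube of scale \<open>j\<close> containing
      \<open>x\<close>, so each superset of \<open>Q\<close> is one of \<open>C k\<close>, ...,
      \<open>C N\<close>. A superset of smaller scale would coincide with \<open>Q\<close>.\<close>
    define C where "C j = dyadic_cube j (\<lambda>i. \<lfloor>x $ i / 2 powi j\<rfloor>)" for j :: int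
    have C: "dyadic_cube j m' = C j" if "x \<in> dyadic_cube j m'" for j m'
      using that by (auto simp: C_def mem_dyadic_cube_iff)
    have "{R \<in> dyadic_upto N. Q \<subseteq> R} \<subseteq> C ` {k..N}"
    proof
      fix R assume "R \<in> {R \<in> dyadic_upto N. Q \<subseteq> R}"
      then obtain j m' where R: "R = dyadic_cube j m'" "j \<le> N" "Q \<subseteq> R"
        by (auto simp: dyadic_upto_def)
      show "R \<in> C ` {k..N}"
      proof (cases "k \<le> j")
        case True
        then show ?thesis using R C[of j m'] x by auto
      next
        case False
        then have "R \<subseteq> Q" using dyadic_cube_mono[of j k x m' m] R Qk x by auto
        then have "R = C k" using R Qk C[of k m] x by auto
        then show ?thesis using Qk by auto
      qed
    qed
    then show ?thesis by (rule finite_subset) simp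
  qed
qed

text \<open>The A_p characteristic is taken over closed cubes, the grid is half-open. They differ by
  subsets of finitely many hyperplanes, which are null sets.\<close>

lemma dyadic_cube_AE_cube:
  fixes m :: "'n::finite \<Rightarrow> int"
  obtains C where "C \<in> cubes" "dyadic_cube k m \<subseteq> C" "AE x in lebesgue. x \<in> dyadic_cube k m \<longleftrightarrow> x \<in> C"
proof
  define a :: "real ^ 'n" where "a = (\<chi> i. 2 powi k * of_int (m i))"
  let ?C = "cbox a (\<chi> i. a $ i + 2 powi k)"
  have "0 < (2::real) powi k" by simp
  then show "?C \<in> cubes" unfolding cubes_def by blast
  show sub: "dyadic_cube k m \<subseteq> ?C"
  proof
    fix x assume "x \<in> dyadic_cube k m"
    then have "a $ i \<le> x $ i \<and> x $ i < a $ i + 2 powi k" for i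
      by (auto simp: dyadic_cube_def a_def algebra_simps)
    then show "x \<in> ?C" by (auto simp: mem_box_cart less_imp_le)
  qed
  have "negligible (\<Union>i\<in>UNIV. {x :: real ^ 'n. x $ i = a $ i + 2 powi k})"
    by (intro negligible_Union finite_imageI) (auto simp: cart_eq_inner_axis intro!: negligible_standard_hyperplane)
  then have null: "(\<Union>i\<in>UNIV. {x :: real ^ 'n. x $ i = a $ i + 2 powi k}) \<in> null_sets lebesgue"
    by (simp add: negligible_iff_null_sets)
  show "AE x in lebesgue. x \<in> dyadic_cube k m \<longleftrightarrow> x \<in> ?C"
  proof (rule AE_I'[OF null], rule subsetI)
    fix x assume "x \<in> {x \<in> space lebesgue. \<not> (x \<in> dyadic_cube k m \<longleftrightarrow> x \<in> ?C)}"
    then have "x \<in> ?C" "x \<notin> dyadic_cube k m" using sub by auto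
    then show "x \<in> (\<Union>i\<in>UNIV. {x. x $ i = a $ i + 2 powi k})"
      by (auto simp: dyadic_cube_def a_def mem_box_cart algebra_simps not_less intro: antisym)
  qed
qed

section \<open>Weights and the A_p condition on cubes\<close>

lemma emeasure_cube:
  assumes "C \<in> cubes"
  obtains r where "0 < r" "emeasure lebesgue C = ennreal r" "compact C" "C \<in> sets lebesgue"
proof -
  obtain a l where C: "C = cbox a (\<chi> i. a $ i + l)" and l: "0 < l"
    using assms by (auto simp: cubes_def)
  have "cbox a (\<chi> i. a $ i + l) \<noteq> {}"
    using l by (auto simp: interval_eq_empty_cart not_less)
  then have "0 < measure lborel C"
    using l by (simp add: C content_cbox_cart prod_pos)
  moreover have "emeasure lebesgue C = ennreal (measure lborel C)"
    using emeasure_lborel_cbox_finite[of a "\<chi> i. a $ i + l"]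
    by (simp add: C emeasure_eq_ennreal_measure)
  ultimately show ?thesis
    by (rule that) (auto simp: C)
qed

lemma weight_measurable:
  assumes "weight v"
  shows "v \<in> borel_measurable lebesgue"
proof (rule borel_measurable_LIMSEQ_real)
  show "(\<lambda>x. indicat_real (cball 0 (real n)) x * v x) \<in> borel_measurable lebesgue" for n
  proof -
    have "integrable lebesgue (\<lambda>x. indicat_real (cball 0 (real n)) x *\<^sub>R v x)"
      using assms compact_cball[of 0 "real n"] unfolding weight_def set_integrable_def by blast
    then show ?thesis using borel_measurable_integrable by force
  qed
  show "(\<lambda>n. indicat_real (cball 0 (real n)) x * v x) \<longlonglongrightarrow> v x" for x
  proof (rule tendsto_eventually)
    obtain n where "norm x \<le> real n" using real_arch_simple by blast
    then show "\<forall>\<^sub>F n in sequentially. indicat_real (cball 0 (real n)) x * v x = v x"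
      by (intro eventually_sequentiallyI[of n]) auto
  qed
qed

lemma weight_integral_finite:
  assumes w: "weight v" and K: "compact K"
  shows "(\<integral>\<^sup>+x\<in>K. ennreal (v x) \<partial>lebesgue) < \<infinity>"
proof -
  have "integrable lebesgue (\<lambda>x. indicat_real K x * v x)"
    using w K by (auto simp: weight_def set_integrable_def)
  then have "(\<integral>\<^sup>+x. ennreal (norm (indicat_real K x * v x)) \<partial>lebesgue) < \<infinity>"
    by (simp add: integrable_iff_bounded)
  moreover have "ennreal (norm (indicat_real K x * v x)) = ennreal (v x) * indicator K x" for x
    using w by (auto simp: weight_def indicator_def)
  ultimately show ?thesis by simp
qed

text \<open>The supremum defining the essential infimum is attained along a sequence, so that only
  countably many null sets have to be united.\<close>

lemma AE_ess_inf_on_le: "AE x in lebesgue. x \<in> Q \<longrightarrow> ess_inf_on Q g \<le> g x"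
proof -
  let ?A = "{a. AE x in lebesgue. x \<in> Q \<longrightarrow> a \<le> g x}"
  have "0 \<in> ?A" by simp
  then have "?A \<noteq> {}" by blast
  from ennreal_Sup_countable_SUP[OF this]
  obtain f :: "nat \<Rightarrow> ennreal" where f: "range f \<subseteq> ?A" "Sup ?A = (SUP i. f i)"
    by (elim exE conjE)
  then have "AE x in lebesgue. \<forall>i. x \<in> Q \<longrightarrow> f i \<le> g x"
    by (subst AE_all_countable) auto
  then show ?thesis
    unfolding ess_inf_on_def f(2) by eventually_elim (auto intro: SUP_least)
qed

lemma le_avg_iff:
  assumes "emeasure lebesgue C = ennreal r" "0 < r"
  shows "a \<le> avg C g \<longleftrightarrow> a * emeasure lebesgue C \<le> (\<integral>\<^sup>+x\<in>C. g x \<partial>lebesgue)"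
    and "avg C g \<le> a \<longleftrightarrow> (\<integral>\<^sup>+x\<in>C. g x \<partial>lebesgue) \<le> a * emeasure lebesgue C"
proof -
  let ?I = "\<integral>\<^sup>+x\<in>C. g x \<partial>lebesgue"
  have *: "a * ennreal r / ennreal r = a" "?I / ennreal r * ennreal r = ?I"
    using assms(2) by (auto simp: ennreal_mult_divide_eq ennreal_divide_times)
  show "a \<le> avg C g \<longleftrightarrow> a * emeasure lebesgue C \<le> ?I"
    using divide_right_mono_ennreal[of "a * ennreal r" ?I "ennreal r"]
      mult_right_mono[of a "?I / ennreal r" "ennreal r"] *
    unfolding avg_def assms(1) by auto
  show "avg C g \<le> a \<longleftrightarrow> ?I \<le> a * emeasure lebesgue C"
    using divide_right_mono_ennreal[of ?I "a * ennreal r" "ennreal r"]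
      mult_right_mono[of "?I / ennreal r" a "ennreal r"] *
    unfolding avg_def assms(1) by auto
qed

text \<open>The \<open>u\<close> of \<open>weighted_family\<close>. For p > 1 it is p' - 1, the
  exponent of the dual weight up to sign, and 1 + 1/u = p. At p = 1 the value 1 is a choice: the A_1
  condition bounds \<open>v\<close> below, and 1 + 1/u = 2.\<close>

definition dual_exponent :: "real \<Rightarrow> real" where
  "dual_exponent p = (if p = 1 then 1 else 1 / (p - 1))"

text \<open>For p = 1 the condition gives v \<ge> b/K almost everywhere on the cube, which is
  inverted pointwise. For p > 1 the bound b Y^(p-1) \<le> K, with \<open>Y\<close> the dual average,
  is raised to the power 1/(p-1).\<close>

lemma Ap_dual_cube:
  assumes p: "1 \<le> p" and K: "Ap_char p v \<le> ennreal K" "0 < K" and v: "\<And>x. 0 \<le> v x"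
    and C: "C \<in> cubes" and b: "0 < b"
    and le: "ennreal b * emeasure lebesgue C \<le> (\<integral>\<^sup>+x\<in>C. ennreal (v x) \<partial>lebesgue)"
  shows "(\<integral>\<^sup>+x\<in>C. epowr (ennreal (v x)) (- dual_exponent p) \<partial>lebesgue)
    \<le> ennreal ((K / b) powr dual_exponent p) * emeasure lebesgue C"
proof -
  obtain r where r: "0 < r" "emeasure lebesgue C = ennreal r" "C \<in> sets lebesgue"
    using emeasure_cube[OF C] by blast
  have bX: "ennreal b \<le> avg C (\<lambda>x. ennreal (v x))"
    using le by (simp add: le_avg_iff[OF r(2,1)])
  show ?thesis
  proof (cases "p = 1")
    case True
    let ?e = "ess_inf_on C (\<lambda>x. ennreal (v x))"
    have "ennreal b * inverse ?e \<le> avg C (\<lambda>x. ennreal (v x)) * inverse ?e"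
      using bX by (rule mult_right_mono) simp
    also have "\<dots> \<le> Ap_char p v"
      unfolding Ap_char_def using True C by (auto intro: SUP_upper)
    also have "\<dots> \<le> ennreal K" by (rule K)
    finally have be: "ennreal b * inverse ?e \<le> ennreal K" .
    have e: "ennreal (b / K) \<le> ?e"
    proof (cases ?e)
      case (real y)
      have "y \<noteq> 0" using be b real by (auto simp: ennreal_mult_top top_unique)
      then have "b / y \<le> K"
        using be b real K by (simp add: inverse_ennreal divide_inverse flip: ennreal_mult)
      then show ?thesis
        using real \<open>y \<noteq> 0\<close> K by (auto intro!: ennreal_leI simp: field_simps)
    qed simp
    have "(\<integral>\<^sup>+x\<in>C. epowr (ennreal (v x)) (- dual_exponent p) \<partial>lebesgue)
        \<le> (\<integral>\<^sup>+x. ennreal (K / b) * indicator C x \<partial>lebesgue)"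
      using AE_ess_inf_on_le[of C "\<lambda>x. ennreal (v x)"]
    proof (intro nn_integral_mono_AE, eventually_elim)
      case (elim x)
      show ?case
      proof (cases "x \<in> C")
        case xC: True
        then have "ennreal (b / K) \<le> ennreal (v x)" using elim e by auto
        then have "b / K \<le> v x" using v by (simp add: ennreal_le_iff)
        moreover from this have "0 < v x" using b K by (smt (verit) divide_pos_pos)
        ultimately show ?thesis
          using True xC b K
          by (auto simp: epowr_ennreal_neg dual_exponent_def powr_minus_divide field_simps
              intro!: ennreal_leI)
      qed simp
    qed
    also have "\<dots> = ennreal ((K / b) powr dual_exponent p) * emeasure lebesgue C"
      using True r b K by (simp add: nn_integral_cmult_indicator dual_exponent_def)
    finally show ?thesis .
  next
    case False
    then have p1: "1 < p" using p by simp
    let ?u = "dual_exponent p"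
    have u: "?u = 1 / (p - 1)" "1 - p / (p - 1) = - ?u"
      using p1 by (auto simp: dual_exponent_def field_simps)
    let ?Y = "avg C (\<lambda>x. epowr (ennreal (v x)) (- ?u))"
    have "ennreal b * epowr ?Y (p - 1) \<le> avg C (\<lambda>x. ennreal (v x)) * epowr ?Y (p - 1)"
      using bX by (rule mult_right_mono) simp
    also have "\<dots> \<le> Ap_char p v"
      unfolding Ap_char_def using p1 C u(2) by (auto simp: Let_def intro!: SUP_upper2[of C])
    also have "\<dots> \<le> ennreal K" by (rule K)
    finally have bY: "ennreal b * epowr ?Y (p - 1) \<le> ennreal K" .
    have "?Y \<le> ennreal ((K / b) powr ?u)"
    proof (cases ?Y)
      case (real y)
      show ?thesis
      proof (cases "y = 0")
        case False
        then have y: "0 < y" using real by simp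
        then have "b * y powr (p - 1) \<le> K"
          using bY real b p1 K by (simp add: epowr_def ennreal_le_iff flip: ennreal_mult)
        then have "y powr (p - 1) \<le> K / b" using b by (simp add: field_simps)
        then have "(y powr (p - 1)) powr ?u \<le> (K / b) powr ?u"
          using p1 by (intro powr_mono2) (auto simp: u)
        then show ?thesis
          using real y p1 by (auto simp: powr_powr u(1) intro!: ennreal_leI)
      qed (use real in simp)
    next
      \<comment> \<open>An infinite dual average would make the product infinite, against the bound
        by \<open>K\<close>.\<close>
      case top
      then show ?thesis using bY b p1 by (simp add: epowr_def ennreal_mult_top top_unique)
    qed
    then show ?thesis by (simp add: le_avg_iff[OF r(2,1)])
  qed
qed

lemma weighted_family_dyadic_upto:
  fixes v :: "real ^ 'n::finite \<Rightarrow> real"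
  assumes p: "1 \<le> p" and K: "Ap_char p v \<le> ennreal K" "0 < K" and w: "weight v"
  shows "weighted_family lebesgue (dyadic_upto N) v K (dual_exponent p)"
proof -
  interpret laminar_family lebesgue "dyadic_upto N :: (real ^ 'n) set set"
    by (rule laminar_family_dyadic_upto)
  note [measurable] = weight_measurable[OF w]
  have v: "0 \<le> v x" for x using w by (simp add: weight_def)
  have cube: "\<exists>C\<in>cubes. Q \<subseteq> C \<and> (AE x in lebesgue. x \<in> Q \<longleftrightarrow> x \<in> C)" if "Q \<in> dyadic_upto N"
    for Q :: "(real ^ 'n) set"
  proof -
    obtain k m where "Q = dyadic_cube k m" using \<open>Q \<in> dyadic_upto N\<close> by (auto simp: dyadic_upto_def)
    then show ?thesis using dyadic_cube_AE_cube[of k m] by metis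
  qed
  have int_eq: "(\<integral>\<^sup>+x\<in>Q. g x \<partial>lebesgue) = (\<integral>\<^sup>+x\<in>C. g x \<partial>lebesgue)"
    if "AE x in lebesgue. x \<in> Q \<longleftrightarrow> x \<in> C" for Q C and g :: "real ^ 'n \<Rightarrow> ennreal"
    using that by (intro nn_integral_cong_AE, eventually_elim) (auto simp: indicator_def)
  show ?thesis
  proof
    fix Q :: "(real ^ 'n) set" assume Q: "Q \<in> dyadic_upto N"
    then obtain C where C: "C \<in> cubes" "Q \<subseteq> C" "AE x in lebesgue. x \<in> Q \<longleftrightarrow> x \<in> C"
      using cube by blast
    have [measurable]: "Q \<in> sets lebesgue" using Q by (rule sets_family)
    obtain r where r: "emeasure lebesgue C = ennreal r" "compact C" and [measurable]: "C \<in> sets lebesgue"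
      using emeasure_cube[OF C(1)] by blast
    have eq: "emeasure lebesgue Q = emeasure lebesgue C"
      using C(3) by (intro emeasure_eq_AE) auto
    then show "emeasure lebesgue Q < \<infinity>" by (simp add: r)
    have N: "emeasure (density lebesgue (\<lambda>x. ennreal (v x))) Q = (\<integral>\<^sup>+x\<in>C. ennreal (v x) \<partial>lebesgue)"
      by (subst emeasure_density) (auto simp: int_eq[OF C(3)])
    then show "emeasure (density lebesgue (\<lambda>x. ennreal (v x))) Q < \<infinity>"
      using weight_integral_finite[OF w r(2)] by simp
    fix b :: real
    assume "0 < b" "ennreal b * emeasure lebesgue Q \<le> emeasure (density lebesgue (\<lambda>x. ennreal (v x))) Q"
    then show "(\<integral>\<^sup>+x\<in>Q. epowr (ennreal (v x)) (- dual_exponent p) \<partial>lebesgue)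
        \<le> ennreal ((K / b) powr dual_exponent p) * emeasure lebesgue Q"
      using Ap_dual_cube[OF p K v C(1)] N eq int_eq[OF C(3)] by simp
  qed (use v p K in \<open>auto simp: dual_exponent_def\<close>)
qed

lemma emeasure_dyadic_cube:
  assumes "Q \<in> dyadic_cubes"
  obtains r where "0 < r" "emeasure lebesgue Q = ennreal r" "Q \<in> sets lebesgue"
proof -
  obtain k m where Q: "Q = dyadic_cube k m" using assms by (auto simp: dyadic_cubes_eq)
  obtain C where C: "C \<in> cubes" "AE x in lebesgue. x \<in> Q \<longleftrightarrow> x \<in> C"
    using dyadic_cube_AE_cube[of k m] Q by metis
  obtain r where r: "0 < r" "emeasure lebesgue C = ennreal r" "C \<in> sets lebesgue"
    using emeasure_cube[OF C(1)] by blast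
  have Qs: "Q \<in> sets lebesgue" by (simp add: Q dyadic_cube_lebesgue)
  then have "emeasure lebesgue Q = emeasure lebesgue C"
    using C(2) r by (intro emeasure_eq_AE) auto
  then show ?thesis using that r Qs by simp
qed

section \<open>The weak norm of the dyadic maximal function\<close>

lemma weak_type_bound:
  fixes v :: "real ^ 'n::finite \<Rightarrow> real"
  assumes p: "1 \<le> p" and K: "Ap_char p v \<le> ennreal K" "0 < K" and w: "weight v"
    and f: "f \<in> borel_measurable lebesgue"
  shows "weak_L1_norm v (\<lambda>x. dyadic_maximal (\<lambda>y. f y * v y) x / ennreal (v x))
    \<le> ennreal (264 * K * p) * L1_norm v f"
  unfolding weak_L1_norm_def
proof (rule SUP_least)
  fix t :: real assume "t \<in> {0<..}"
  then have t: "0 < t" by simp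
  note [measurable] = weight_measurable[OF w] f
  have v: "0 \<le> v x" for x using w by (simp add: weight_def)
  define h where "h x = ennreal \<bar>f x * v x\<bar>" for x
  \<comment> \<open>Dividing by \<open>t\<close> turns the level condition into the comparison of
    \<open>v\<close> with an average that \<open>maximal_weak_type\<close> handles.\<close>
  define G where "G = density lebesgue (\<lambda>x. ennreal (1 / t) * h x)"
  have [measurable]: "h \<in> borel_measurable lebesgue" unfolding h_def by measurable
  have G: "emeasure G A = ennreal (1 / t) * (\<integral>\<^sup>+x\<in>A. h x \<partial>lebesgue)" if "A \<in> sets lebesgue" for A
    using that unfolding G_def by (subst emeasure_density) (auto simp: mult.assoc nn_integral_cmult)
  have GL: "emeasure G (space lebesgue) = ennreal (1 / t) * L1_norm v f"
  proof -
    have "L1_norm v f = (\<integral>\<^sup>+x. ennreal (v x) * ennreal \<bar>f x\<bar> \<partial>lebesgue)"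
      unfolding L1_norm_def weighted_def by (subst nn_integral_density) auto
    also have "\<dots> = (\<integral>\<^sup>+x\<in>space lebesgue. h x \<partial>lebesgue)"
      using v by (intro nn_integral_cong) (auto simp: h_def abs_mult mult.commute simp flip: ennreal_mult)
    finally show ?thesis by (simp add: G)
  qed
  \<comment> \<open>The bound for the grid capped at scale \<open>N\<close> does not depend on
    \<open>N\<close>, so it passes to the increasing union by continuity from below.\<close>
  define E where "E N = {x. \<exists>Q\<in>dyadic_upto (int N).
      x \<in> Q \<and> ennreal (v x) * emeasure lebesgue Q < emeasure G Q}" for N :: nat
  let ?B = "ennreal (132 * K * (1 + 1 / dual_exponent p)) * emeasure G (space lebesgue)"
  have E_sets: "E N \<in> sets lebesgue" and E_le: "emeasure (weighted v) (E N) \<le> ?B" for N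
  proof -
    interpret weighted_family lebesgue "dyadic_upto (int N)" v K "dual_exponent p"
      using p K w by (rule weighted_family_dyadic_upto)
    show "E N \<in> sets lebesgue"
      unfolding E_def by (rule sets_exists_family) measurable
    show "emeasure (weighted v) (E N) \<le> ?B"
      using maximal_weak_type[of "\<lambda>x. ennreal (1 / t) * h x"]
      by (simp add: E_def weighted_def G_def)
  qed
  have "dyadic_upto (int i) \<subseteq> (dyadic_upto (int j) :: (real ^ 'n) set set)" if "i \<le> j" for i j
    using that by (force simp: dyadic_upto_def)
  then have "incseq E"
    unfolding incseq_def E_def by blast
  \<comment> \<open>Where \<open>v\<close> vanishes the quotient may be infinite; that set is set
    aside because it has weighted measure 0.\<close>
  have sub: "{x. ennreal t < dyadic_maximal (\<lambda>y. f y * v y) x / ennreal (v x)} \<subseteq> {x. v x = 0} \<union> (\<Union>N. E N)"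
  proof
    fix x assume "x \<in> {x. ennreal t < dyadic_maximal (\<lambda>y. f y * v y) x / ennreal (v x)}"
    then have less: "ennreal t < dyadic_maximal (\<lambda>y. f y * v y) x / ennreal (v x)" by simp
    show "x \<in> {x. v x = 0} \<union> (\<Union>N. E N)"
    proof (cases "v x = 0")
      case False
      then have vx: "0 < v x" using v[of x] by simp
      have "ennreal t * ennreal (v x) < dyadic_maximal (\<lambda>y. f y * v y) x"
      proof (rule ccontr)
        assume "\<not> ?thesis"
        then have "dyadic_maximal (\<lambda>y. f y * v y) x / ennreal (v x) \<le> ennreal t * ennreal (v x) / ennreal (v x)"
          by (intro divide_right_mono_ennreal) simp
        then show False using less vx by (simp add: ennreal_mult_divide_eq)
      qed
      then obtain Q where Q: "Q \<in> dyadic_cubes" "x \<in> Q" and lt: "ennreal t * ennreal (v x) < avg Q h"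
        unfolding dyadic_maximal_def h_def by (auto simp: less_SUP_iff)
      obtain r where r: "0 < r" "emeasure lebesgue Q = ennreal r" "Q \<in> sets lebesgue"
        using emeasure_dyadic_cube[OF Q(1)] by blast
      have "\<not> emeasure G Q \<le> ennreal (v x) * emeasure lebesgue Q"
      proof
        assume "emeasure G Q \<le> ennreal (v x) * emeasure lebesgue Q"
        then have "ennreal t * (ennreal (1 / t) * (\<integral>\<^sup>+x\<in>Q. h x \<partial>lebesgue))
            \<le> ennreal t * (ennreal (v x) * emeasure lebesgue Q)"
          by (intro mult_left_mono) (auto simp: G r)
        moreover have "ennreal t * (ennreal (1 / t) * (\<integral>\<^sup>+x\<in>Q. h x \<partial>lebesgue)) = (\<integral>\<^sup>+x\<in>Q. h x \<partial>lebesgue)"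
          using t by (subst ennreal_mult_mult[where c = 1]) auto
        ultimately have "avg Q h \<le> ennreal t * ennreal (v x)"
          by (simp add: le_avg_iff[OF r(2,1)] mult.assoc)
        with lt show False by simp
      qed
      moreover obtain k m where km: "Q = dyadic_cube k m" using Q by (auto simp: dyadic_cubes_eq)
      \<comment> \<open>For negative \<open>k\<close> the cap \<open>int (nat k)\<close> is 0, which
        still admits the cube.\<close>
      then have "Q \<in> dyadic_upto (int (nat k))" unfolding dyadic_upto_def by auto
      ultimately have "x \<in> E (nat k)" using Q unfolding E_def not_le by blast
      then show ?thesis by blast
    qed simp
  qed
  have "{x \<in> space lebesgue. v x = 0} \<in> sets lebesgue" by measurable
  then have zero: "{x. v x = 0} \<in> sets lebesgue" by simp
  have "emeasure (weighted v) {x. ennreal t < dyadic_maximal (\<lambda>y. f y * v y) x / ennreal (v x)}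
      \<le> emeasure (weighted v) ({x. v x = 0} \<union> (\<Union>N. E N))"
    using sub E_sets zero by (intro emeasure_mono) (auto simp: weighted_def)
  also have "\<dots> \<le> emeasure (weighted v) {x. v x = 0} + emeasure (weighted v) (\<Union>N. E N)"
    using E_sets zero by (intro emeasure_subadditive) (auto simp: weighted_def)
  also have "emeasure (weighted v) {x. v x = 0} = 0"
  proof -
    have "emeasure (weighted v) {x. v x = 0} = (\<integral>\<^sup>+x. ennreal (v x) * indicator {x. v x = 0} x \<partial>lebesgue)"
      unfolding weighted_def using zero by (subst emeasure_density) auto
    moreover have "ennreal (v x) * indicator {x. v x = 0} x = 0" for x
      by (auto simp: indicator_def)
    ultimately show ?thesis by simp
  qed
  also have "emeasure (weighted v) (\<Union>N. E N) = (SUP N. emeasure (weighted v) (E N))"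
    using E_sets \<open>incseq E\<close> by (intro SUP_emeasure_incseq[symmetric]) (auto simp: weighted_def)
  also have "0 + \<dots> \<le> ?B"
    using E_le by (auto intro: SUP_least)
  finally have "ennreal t * emeasure (weighted v) {x. ennreal t < dyadic_maximal (\<lambda>y. f y * v y) x / ennreal (v x)}
      \<le> ennreal t * ?B"
    by (rule mult_left_mono) simp
  also have "\<dots> = ennreal (132 * K * (1 + 1 / dual_exponent p)) * L1_norm v f"
  proof -
    have cancel: "ennreal t * (ennreal (1 / t) * L1_norm v f) = L1_norm v f"
      using t by (subst ennreal_mult_mult[where c = 1]) auto
    show ?thesis unfolding GL by (subst mult.left_commute) (simp only: cancel)
  qed
  \<comment> \<open>Here 1 + 1/u is p for p > 1 and 2 for p = 1, hence at most 2p in both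
    cases.\<close>
  also have "\<dots> \<le> ennreal (264 * K * p) * L1_norm v f"
    using p K by (intro mult_right_mono ennreal_leI) (auto simp: dual_exponent_def)
  finally show "ennreal t * emeasure (weighted v) {x. ennreal t < dyadic_maximal (\<lambda>y. f y * v y) x / ennreal (v x)}
      \<le> ennreal (264 * K * p) * L1_norm v f" .
qed

theorem corollary1p14:
  shows "\<exists>c :: real. 0 < c \<and>
    (\<forall>(p :: real) (v :: real ^ 'n :: finite \<Rightarrow> real) (f :: real ^ 'n \<Rightarrow> real).
      1 \<le> p \<longrightarrow> v \<in> Ap p \<longrightarrow> integrable (weighted v) f \<longrightarrow>
      weak_L1_norm v (\<lambda>x. dyadic_maximal (\<lambda>y. f y * v y) x / ennreal (v x))
        \<le> ennreal (c * enn2real (Ap_char p v)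
              * max p (ln (exp 1 + enn2real (Ap_char p v))))
          * L1_norm v f)"
proof (intro exI[of _ 264] conjI allI impI)
  fix p :: real and v f :: "real ^ 'n \<Rightarrow> real"
  assume p: "1 \<le> p" and v: "v \<in> Ap p" and f: "integrable (weighted v) f"
  let ?W = "weak_L1_norm v (\<lambda>x. dyadic_maximal (\<lambda>y. f y * v y) x / ennreal (v x))"
  define K where "K = enn2real (Ap_char p v)"
  have w: "weight v" and K: "Ap_char p v = ennreal K" "0 \<le> K"
    using v by (auto simp: Ap_def K_def)
  have fm: "f \<in> borel_measurable lebesgue"
    using borel_measurable_integrable[OF f] by (simp add: weighted_def measurable_density_eq1 cong: measurable_cong_sets)
  have bound: "?W \<le> ennreal (264 * K' * p) * L1_norm v f" if "K \<le> K'" "0 < K'" for K'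
    using that K by (intro weak_type_bound p w fm) (auto intro: ennreal_leI)
  have "?W \<le> ennreal (264 * K * p) * L1_norm v f"
  \<comment> \<open>The bound \<open>weak_type_bound\<close> asks for a positive constant. For
    characteristic 0 it is applied with arbitrarily small \<open>K'\<close>, and the finite norm of
    \<open>f\<close> lets the right side tend to 0.\<close>
  proof (cases "K = 0")
    case True
    have "L1_norm v f < \<infinity>"
      using f by (simp add: L1_norm_def integrable_iff_bounded)
    then obtain l where l: "L1_norm v f = ennreal l" "0 \<le> l" by (cases "L1_norm v f") auto
    have "?W \<le> 0"
    proof (rule ennreal_le_epsilon)
      fix e :: real assume e: "0 < e"
      \<comment> \<open>Using \<open>l + 1\<close> instead of \<open>l\<close> avoids a zero
        denominator.\<close>
      define K' where "K' = e / (264 * p * (l + 1))"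
      have K': "0 < K'" using e p l by (simp add: K'_def)
      have "264 * K' * p * l \<le> 264 * K' * p * (l + 1)"
        using K' p by (intro mult_left_mono) auto
      also have "\<dots> = e" using p l by (simp add: K'_def)
      finally have "264 * K' * p * l \<le> e" .
      then show "?W \<le> 0 + ennreal e"
        using order_trans[OF bound[of K']] True K' l p by (auto simp: ennreal_leI simp flip: ennreal_mult)
    qed
    then show ?thesis by simp
  qed (use bound[of K] K in auto)
  also have "\<dots> \<le> ennreal (264 * K * max p (ln (exp 1 + K))) * L1_norm v f"
    using K by (intro mult_right_mono ennreal_leI mult_left_mono) auto
  finally show "?W \<le> ennreal (264 * enn2real (Ap_char p v)
      * max p (ln (exp 1 + enn2real (Ap_char p v)))) * L1_norm v f"
    by (simp add: K_def)
qed simp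

end
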